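(* Let $p$ be a prime, $n\ge1$, $q=p^n$, let $\gamma\in\mathbb{F}_q^*$ have multiplicative order $T$, and $G=\langle\gamma\rangle$. Let $d:G\to\mathbb{F}_q$ be given by $d(\gamma^x)=\gamma^{x^2}$. Let $m$ be an integer with $0\le m\le T$ and $F:\mathbb{F}_q\to\mathbb{F}_q$ a map with $F(\zeta)=d(\zeta)$ for all but at most $m$ elements $\zeta\in G$. Suppose there exist an $\mathbb{F}_p$-linear subspace $U\le \mathbb{F}_q$ of codimension $k$, a linearised polynomial $M\in\mathbb{F}_q[X]$ and constants $a_V\in\mathbb{F}_q$ indexed by the cosets $V$ of $U$, such that $F(\zeta)=M(\zeta)+a_{U+\zeta}$ for all $\zeta\in\mathbb{F}_q$. If $f>2$ is a common divisor of $T$ and $p-1$, then $$p^k\ge \frac{N(T)}{9f}-\frac{2m}{f}.$$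
   Context: A linearised polynomial over $\mathbb{F}_q$ is one of the form $\sum_{j=0}^{n-1}c_jX^{p^j}$, $c_j\in\mathbb{F}_q$. $N(T)$ denotes the number of squares modulo $T$, i.e. the number of residues $a\in\{0,\ldots,T-1\}$ such that $x^2\equiv a\pmod T$ has a solution. *)

theory Defs
  imports Complex_Main "HOL-Library.Cardinality" "HOL-Computational_Algebra.Computational_Algebra" "HOL-Number_Theory.Cong"
begin

(* The prime field F_p as a type of its own, realised as the set of integer multiples of 1 inside
   the finite field 'a. Having it as a type makes the library's vector_space locale (subspaces,
   dimension) available for 'a regarded as an F_p-vector space. *)
typedef (overloaded) ('a :: finite_field) prime_subfield = "range (of_int :: int \<Rightarrow> 'a)"
  by blast

setup_lifting type_definition_prime_subfield

lemma inverse_in_range_of_int: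
  fixes x :: "'a :: finite_field"
  assumes "x \<in> range of_int"
  shows "inverse x \<in> range of_int"
proof (cases "x = 0")
  case True
  then have "inverse x = of_int 0"
    by simp
  then show ?thesis
    by blast
next
  case False
  let ?S = "range (of_int :: int \<Rightarrow> 'a)"
  have "(*) x ` ?S \<subseteq> ?S"
    using assms by (auto simp flip: of_int_mult)
  moreover have "inj_on ((*) x) ?S"
    using False by (auto simp: inj_on_def)
  ultimately have "(*) x ` ?S = ?S"
    by (intro endo_inj_surj) auto
  moreover have "(1 :: 'a) \<in> ?S"
    using of_int_1 by (metis rangeI)
  ultimately obtain y where "y \<in> ?S" "x * y = 1"
    by (metis imageE)
  then show ?thesis
    using inverse_unique by metis
qed

instantiation prime_subfield :: (finite_field) field
begin

lift_definition zero_prime_subfield :: "'a prime_subfield" is 0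
  by (metis of_int_0 rangeI)

lift_definition one_prime_subfield :: "'a prime_subfield" is 1
  by (metis of_int_1 rangeI)

lift_definition plus_prime_subfield :: "'a prime_subfield \<Rightarrow> 'a prime_subfield \<Rightarrow> 'a prime_subfield"
  is "(+)" by (metis (no_types, opaque_lifting) image_iff of_int_add rangeI)

lift_definition uminus_prime_subfield :: "'a prime_subfield \<Rightarrow> 'a prime_subfield"
  is uminus by (metis (no_types, opaque_lifting) image_iff of_int_minus rangeI)

lift_definition minus_prime_subfield :: "'a prime_subfield \<Rightarrow> 'a prime_subfield \<Rightarrow> 'a prime_subfield"
  is "(-)" by (metis (no_types, opaque_lifting) image_iff of_int_diff rangeI)

lift_definition times_prime_subfield :: "'a prime_subfield \<Rightarrow> 'a prime_subfield \<Rightarrow> 'a prime_subfield"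
  is "(*)" by (metis (no_types, opaque_lifting) image_iff of_int_mult rangeI)

lift_definition inverse_prime_subfield :: "'a prime_subfield \<Rightarrow> 'a prime_subfield"
  is inverse by (rule inverse_in_range_of_int)

definition divide_prime_subfield :: "'a prime_subfield \<Rightarrow> 'a prime_subfield \<Rightarrow> 'a prime_subfield"
  where "divide_prime_subfield x y = x * inverse y"

instance
  by standard (simp add: divide_prime_subfield_def | (transfer; simp add: algebra_simps))+

end

definition scale_prime_subfield :: "'a :: finite_field prime_subfield \<Rightarrow> 'a \<Rightarrow> 'a"
  where "scale_prime_subfield c x = Rep_prime_subfield c * x"

interpretation Fp: vector_space scale_prime_subfield
  by standard
    (simp_all add: scale_prime_subfield_def algebra_simps plus_prime_subfield.rep_eq
      times_prime_subfield.rep_eq one_prime_subfield.rep_eq)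

definition mult_order :: "'a :: field \<Rightarrow> nat"
  where "mult_order \<gamma> = (LEAST t. t > 0 \<and> \<gamma> ^ t = 1)"

definition cyclic_subgroup :: "'a :: field \<Rightarrow> 'a set"
  where "cyclic_subgroup \<gamma> = range (\<lambda>x :: int. \<gamma> powi x)"

(* Linearised polynomials over a field with p^n elements. *)
definition linearised_poly :: "nat \<Rightarrow> nat \<Rightarrow> 'a :: field poly \<Rightarrow> bool"
  where "linearised_poly p n M \<longleftrightarrow> (\<exists>c. M = (\<Sum>j<n. monom (c j) (p ^ j)))"

definition num_squares_mod :: "nat \<Rightarrow> nat"
  where "num_squares_mod T = card {a. a < T \<and> (\<exists>x. [x\<^sup>2 = a] (mod T))}"

(* The exponent of a power of gamma is determined modulo the order of gamma, and so is its
   square: the rule gamma^x |-> gamma^(x^2) does define a map on the generated group. *)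
lemma power_square_map_well_defined:
  fixes \<gamma> :: "'a :: field"
  assumes "\<gamma> \<noteq> 0" "\<gamma> powi x = \<gamma> powi y"
  shows "\<gamma> powi (x\<^sup>2) = \<gamma> powi (y\<^sup>2)"
proof -
  have "\<gamma> powi (x - y) = 1"
    using assms by (simp add: power_int_diff)
  then have "\<gamma> powi ((x - y) * (x + y)) = 1"
    by (simp add: power_int_mult)
  moreover have "x\<^sup>2 = (x - y) * (x + y) + y\<^sup>2"
    by (simp add: power2_eq_square algebra_simps)
  ultimately show ?thesis
    using assms by (simp add: power_int_add)
qed

end

theory Submission
  imports Defs
begin

text \<open>
  Put \<open>h = T div f\<close>. The element \<open>w = \<gamma> ^ h\<close> has order \<open>f\<close> dividing \<open>p - 1\<close>, hence lies in the prime
  field, so \<open>M\<close> commutes with multiplication by \<open>w\<close>, which permutes the cosets of \<open>U\<close>. Therefore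
  \<open>F (w * z) - w * F z\<close> depends only on the coset of \<open>z\<close> and takes at most \<open>p ^ k\<close> values. When \<open>F\<close>
  agrees with \<open>d\<close> at \<open>z = \<gamma> ^ x\<close> and at \<open>w * z\<close>, this value is
  \<open>\<gamma> ^ (x\<^sup>2) * (w ^ (2 * x + h) - w)\<close>. If the second factor is nonzero, that is, if \<open>2 * x + h\<close> is not
  \<open>1\<close> modulo \<open>f\<close>, the value arises from at most \<open>f\<close> different \<open>\<gamma> ^ (x\<^sup>2)\<close>. It remains to see that
  such \<open>x\<close> yield at least a ninth of all squares modulo \<open>T\<close>; by the Chinese remainder theorem
  this reduces to counting unit squares modulo a prime power \<open>q\<close>, of which there are at least
  \<open>q / 8\<close>.
\<close>

section \<open>Counting squares modulo T whose roots are restricted\<close>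

definition squares_mod :: "int \<Rightarrow> int set \<Rightarrow> int set"
  where "squares_mod N X = (\<lambda>x. x\<^sup>2 mod N) ` X"

lemma squares_mod_subset: "N > 0 \<Longrightarrow> squares_mod N X \<subseteq> {0..<N}"
  by (auto simp: squares_mod_def)

lemma finite_squares_mod: "N > 0 \<Longrightarrow> finite (squares_mod N X)"
  by (rule finite_subset[OF squares_mod_subset]) auto

lemma card_squares_mod_eq_num_squares_mod:
  assumes "T > 0"
  shows "card (squares_mod (int T) UNIV) = num_squares_mod T"
proof -
  have "squares_mod (int T) UNIV = int ` {a. a < T \<and> (\<exists>x. [x\<^sup>2 = a] (mod T))}"
  proof (intro equalityI subsetI)
    fix y assume "y \<in> squares_mod (int T) UNIV"
    then obtain x where y: "y = x\<^sup>2 mod int T" by (auto simp: squares_mod_def)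
    define a where "a = (nat \<bar>x\<bar>)\<^sup>2 mod T"
    have "y = int a" by (simp add: y a_def zmod_int)
    moreover have "a < T" "[(nat \<bar>x\<bar>)\<^sup>2 = a] (mod T)" using assms by (simp_all add: a_def cong_def)
    ultimately show "y \<in> int ` {a. a < T \<and> (\<exists>x. [x\<^sup>2 = a] (mod T))}" by blast
  next
    fix y assume "y \<in> int ` {a. a < T \<and> (\<exists>x. [x\<^sup>2 = a] (mod T))}"
    then obtain a x where "a < T" "[x\<^sup>2 = a] (mod T)" "y = int a" by auto
    then have "y = (int x)\<^sup>2 mod int T"
      by (simp add: cong_def flip: of_nat_power zmod_int)
    then show "y \<in> squares_mod (int T) UNIV" by (auto simp: squares_mod_def)
  qed
  then show ?thesis by (simp add: card_image num_squares_mod_def)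
qed

text \<open>By the Chinese remainder theorem a square modulo \<open>A * B\<close> is fixed by its
  residue modulo \<open>A\<close>, counted crudely among all residues, and by a square modulo
  \<open>B\<close>.\<close>

lemma card_squares_mod_mult_le:
  fixes A B :: int
  assumes "coprime A B" "A > 0" "B > 0"
  shows "card (squares_mod (A * B) UNIV) \<le> nat A * card (squares_mod B UNIV)"
proof -
  let ?h = "\<lambda>a. (a mod A, a mod B)"
  have "inj_on ?h (squares_mod (A * B) UNIV)"
  proof (rule inj_onI)
    fix a b
    assume ab: "a \<in> squares_mod (A * B) UNIV" "b \<in> squares_mod (A * B) UNIV" and "?h a = ?h b"
    then have "[a = b] (mod A * B)"
      using assms by (intro coprime_cong_mult) (auto simp: cong_def)
    with ab show "a = b" by (auto simp: cong_def squares_mod_def)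
  qed
  moreover have "?h ` squares_mod (A * B) UNIV \<subseteq> {0..<A} \<times> squares_mod B UNIV"
    using assms by (auto simp: squares_mod_def mod_mult2_eq mod_mod_cancel)
  ultimately have "card (squares_mod (A * B) UNIV) \<le> card ({0..<A} \<times> squares_mod B UNIV)"
    using assms by (intro card_inj_on_le) (auto simp: finite_squares_mod)
  then show ?thesis by (simp add: card_cartesian_product)
qed

text \<open>A root in \<open>X\<close> modulo \<open>A\<close> and any root modulo \<open>B\<close>
  glue to one root modulo \<open>A * B\<close>, which the congruence hypothesis puts into
  \<open>Y\<close>.\<close>

lemma card_squares_mod_mult_ge:
  fixes A B :: int
  assumes "coprime A B" "A > 0" "B > 0"
    and X: "\<And>x y. x \<in> X \<Longrightarrow> [y = x] (mod A) \<Longrightarrow> y \<in> Y"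
  shows "card (squares_mod A X) * card (squares_mod B UNIV) \<le> card (squares_mod (A * B) Y)"
proof -
  let ?h = "\<lambda>a. (a mod A, a mod B)"
  have "squares_mod A X \<times> squares_mod B UNIV \<subseteq> ?h ` squares_mod (A * B) Y"
  proof safe
    fix u v assume "u \<in> squares_mod A X" "v \<in> squares_mod B UNIV"
    then obtain x y where xy: "x \<in> X" "u = x\<^sup>2 mod A" "v = y\<^sup>2 mod B"
      by (auto simp: squares_mod_def)
    obtain z where z: "[z = x] (mod A)" "[z = y] (mod B)"
      using binary_chinese_remainder_int[OF assms(1)] by blast
    have "(u, v) = ?h (z\<^sup>2 mod (A * B))"
      using cong_pow[OF z(1), of 2] cong_pow[OF z(2), of 2] xy
      by (simp add: cong_def mod_mod_cancel)
    then show "(u, v) \<in> ?h ` squares_mod (A * B) Y"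
      using X[OF xy(1) z(1)] by (auto simp: squares_mod_def)
  qed
  then have "card (squares_mod A X \<times> squares_mod B UNIV) \<le> card (squares_mod (A * B) Y)"
    using assms by (intro surj_card_le) (auto simp: finite_squares_mod)
  then show ?thesis by (simp add: card_cartesian_product)
qed

text \<open>If \<open>r\<close> misses one of \<open>y - x\<close> and \<open>y + x\<close>, then
  \<open>r ^ e\<close> divides the other. The factor 2 in the conclusion makes room for
  \<open>r = 2\<close>, where both can be even.\<close>

lemma square_cong_square_prime_power:
  fixes x y r :: int
  assumes "prime r" "\<not> r dvd x" "[y\<^sup>2 = x\<^sup>2] (mod r ^ e)"
  shows "[2 * y = 2 * x] (mod r ^ e) \<or> [2 * y = - 2 * x] (mod r ^ e)"
proof -
  have *: "r ^ e dvd (y - x) * (y + x)"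
    using assms(3) by (simp add: cong_iff_dvd_diff power2_eq_square algebra_simps)
  have cop: "coprime (r ^ e) z" if "\<not> r dvd z" for z
    using assms(1) that by (simp add: prime_imp_coprime)
  show ?thesis
  proof (cases "r dvd y - x \<and> r dvd y + x")
    case False
    then have "r ^ e dvd y + x \<or> r ^ e dvd y - x"
      using * cop coprime_dvd_mult_right_iff coprime_dvd_mult_left_iff by blast
    then have "r ^ e dvd 2 * (y + x) \<or> r ^ e dvd 2 * (y - x)" by (metis dvd_mult)
    then show ?thesis by (auto simp: cong_iff_dvd_diff algebra_simps)
  next
    case True
    then have "r dvd (y + x) - (y - x)" by (blast intro: dvd_diff)
    then have "r dvd 2 * x" by (simp add: algebra_simps)
    then have "r dvd 2" using assms by (simp add: prime_dvd_mult_iff)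
    then have r: "r = 2" using assms(1) by (simp add: primes_dvd_imp_eq)
    obtain u where u: "y - x = 2 * u" using True r by blast
    have v: "y + x = 2 * (u + x)" using u by simp
    have 4: "r ^ e dvd 4 * (u * (u + x))" using * unfolding u v by (simp add: algebra_simps)
    \<comment> \<open>\<open>u\<close> and \<open>u + x\<close> differ by \<open>x\<close>, so one
      of them is prime to \<open>r\<close> and cancels.\<close>
    have "\<not> r dvd u \<or> \<not> r dvd u + x" using assms(2) by (metis dvd_add_right_iff)
    then have "r ^ e dvd 4 * (u + x) \<or> r ^ e dvd 4 * u"
      using 4 cop coprime_dvd_mult_left_iff[of "r ^ e" u "4 * (u + x)"]
        coprime_dvd_mult_left_iff[of "r ^ e" "u + x" "4 * u"]
      by (auto simp: mult_ac)
    moreover have "2 * y - (- 2 * x) = 4 * (u + x)" "2 * y - 2 * x = 4 * u" using u by auto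
    ultimately show ?thesis unfolding cong_iff_dvd_diff by metis
  qed
qed

text \<open>Since \<open>2 * y\<close> lies between 0 and \<open>2 * q\<close>, it can only be
  \<open>c mod q\<close> or \<open>c mod q + q\<close>.\<close>

lemma card_double_cong_le:
  fixes c q :: int
  shows "card {y \<in> {0..<q}. [2 * y = c] (mod q)} \<le> 2"
proof -
  have "{y \<in> {0..<q}. [2 * y = c] (mod q)} \<subseteq> {c mod q div 2, (c mod q + q) div 2}"
  proof
    fix y assume "y \<in> {y \<in> {0..<q}. [2 * y = c] (mod q)}"
    then have y: "0 \<le> y" "y < q" "(2 * y) mod q = c mod q" by (auto simp: cong_def)
    have "(2 * y) mod q = (if 2 * y < q then 2 * y else 2 * y - q)"
      using y(1,2) mod_pos_pos_trivial[of "2 * y" q] mod_pos_pos_trivial[of "2 * y - q" q]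
        minus_mod_self2[of "2 * y" q] by (cases "2 * y < q") simp_all
    with y show "y \<in> {c mod q div 2, (c mod q + q) div 2}" by (auto split: if_splits)
  qed
  then have "card {y \<in> {0..<q}. [2 * y = c] (mod q)} \<le> card {c mod q div 2, (c mod q + q) div 2}"
    by (intro card_mono) auto
  also have "\<dots> \<le> 2" by (simp add: card_insert_if)
  finally show ?thesis .
qed

text \<open>The 8 is 2 times 4: at least half of the residues are prime to \<open>r\<close>, and a
  square has at most 4 roots among them, namely two solutions \<open>y\<close> of the congruence for
  \<open>2 * y\<close> for each of two signs.\<close>

lemma prime_power_le_8_card_squares_mod:
  fixes r :: int
  assumes "prime r" "e > 0"
  shows "nat (r ^ e) \<le> 8 * card (squares_mod (r ^ e) {x. \<not> r dvd x})"
proof -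
  define q where "q = r ^ e"
  have r: "r \<ge> 2" using assms(1) prime_ge_2_int by blast
  have q: "q > 0" and rq: "r dvd q" using r assms(2) by (auto simp: q_def)
  define X where "X = {x \<in> {0..<q}. \<not> r dvd x}"
  have finX: "finite X" by (rule finite_subset[of _ "{0..<q}"]) (auto simp: X_def)
  have img: "squares_mod q {x. \<not> r dvd x} = squares_mod q X"
  proof -
    have "x\<^sup>2 mod q \<in> squares_mod q X" if "\<not> r dvd x" for x
    proof -
      have "x mod q \<in> X" using that q rq by (simp add: X_def dvd_mod_iff)
      moreover have "x\<^sup>2 mod q = (x mod q)\<^sup>2 mod q" by (simp add: power_mod)
      ultimately show ?thesis by (auto simp: squares_mod_def)
    qed
    then show ?thesis by (auto simp: squares_mod_def X_def)
  qed
  have fibre: "card {y \<in> X. y\<^sup>2 mod q = s} \<le> 4" for s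
  proof (cases "\<exists>x \<in> X. x\<^sup>2 mod q = s")
    case False
    then have "{y \<in> X. y\<^sup>2 mod q = s} = {}" by blast
    then show ?thesis by (metis card.empty zero_le)
  next
    case True
    then obtain x where x: "x \<in> X" "x\<^sup>2 mod q = s" by blast
    let ?D = "\<lambda>c. {y \<in> {0..<q}. [2 * y = c] (mod q)}"
    have finD: "finite (?D c)" for c by (rule finite_subset[of _ "{0..<q}"]) auto
    have "{y \<in> X. y\<^sup>2 mod q = s} \<subseteq> ?D (2 * x) \<union> ?D (- 2 * x)"
      using square_cong_square_prime_power[OF assms(1), of x _ e] x
      by (auto simp: X_def q_def cong_def)
    then have "card {y \<in> X. y\<^sup>2 mod q = s} \<le> card (?D (2 * x) \<union> ?D (- 2 * x))"
      by (intro card_mono finite_UnI finD)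
    also have "\<dots> \<le> card (?D (2 * x)) + card (?D (- 2 * x))" by (rule card_Un_le)
    also have "\<dots> \<le> 4"
      using card_double_cong_le[of q "2 * x"] card_double_cong_le[of q "- 2 * x"] by linarith
    finally show ?thesis .
  qed
  have "card X \<le> (\<Sum>s\<in>squares_mod q X. card {y \<in> X. y\<^sup>2 mod q = s})"
  proof -
    have "X = (\<Union>s\<in>squares_mod q X. {y \<in> X. y\<^sup>2 mod q = s})" by (auto simp: squares_mod_def)
    then have "card X = card (\<Union>s\<in>squares_mod q X. {y \<in> X. y\<^sup>2 mod q = s})" by simp
    also have "\<dots> \<le> (\<Sum>s\<in>squares_mod q X. card {y \<in> X. y\<^sup>2 mod q = s})"
      by (rule card_UN_le) (rule finite_squares_mod[OF q])
    finally show ?thesis .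
  qed
  also have "\<dots> \<le> (\<Sum>s\<in>squares_mod q X. 4)" by (rule sum_mono) (rule fibre)
  finally have cardX: "card X \<le> 4 * card (squares_mod q X)" by simp
  \<comment> \<open>Shifting by 1 maps multiples of \<open>r\<close> to non-multiples. It never
    reaches \<open>q\<close>, which is itself a multiple of \<open>r\<close>.\<close>
  have "card {x \<in> {0..<q}. r dvd x} \<le> card X"
  proof (rule card_inj_on_le)
    show "inj_on (\<lambda>x. x + 1) {x \<in> {0..<q}. r dvd x}" by simp
    show "(\<lambda>x. x + 1) ` {x \<in> {0..<q}. r dvd x} \<subseteq> X"
    proof (clarify)
      fix x assume x: "x \<in> {0..<q}" "r dvd x"
      then have "\<not> r dvd x + 1" using r by (metis dvd_add_right_iff not_prime_unit assms(1))
      moreover have "x + 1 \<noteq> q" using calculation rq by auto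
      ultimately show "x + 1 \<in> X" using x by (auto simp: X_def)
    qed
  qed (rule finX)
  moreover have "{0..<q} = X \<union> {x \<in> {0..<q}. r dvd x}" by (auto simp: X_def)
  then have "card {0..<q} \<le> card X + card {x \<in> {0..<q}. r dvd x}" by (metis card_Un_le)
  ultimately show ?thesis using cardX img by (simp add: q_def)
qed

text \<open>If \<open>f\<close> is twice an odd number, that number exceeds 1 and supplies the odd
  prime.\<close>

lemma odd_prime_or_4_dvd:
  fixes f :: nat
  assumes "f > 2"
  shows "(\<exists>r. prime r \<and> odd r \<and> r dvd f) \<or> 4 dvd f"
proof -
  have odd_case: "\<exists>r. prime r \<and> odd r \<and> r dvd g" if "odd g" "g \<noteq> 1" for g :: nat
    using prime_factor_nat[OF that(2)] that(1) by (metis dvd_trans)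
  show ?thesis
  proof (cases "odd f")
    case True
    then show ?thesis using odd_case[of f] assms by simp
  next
    case False
    then obtain g where g: "f = 2 * g" by blast
    show ?thesis
    proof (cases "even g")
      case True
      then show ?thesis using g by (auto simp: dvd_def)
    next
      case False
      then show ?thesis using odd_case[of g] g assms by (metis dvd_mult mult_2 nat_less_le one_add_one)
    qed
  qed
qed

text \<open>The squares modulo \<open>B\<close> contribute the same factor to both sides, so only
  \<open>A\<close> matters. The constant 9 covers both uses: 8 for prime powers and 4 for the
  modulus 4.\<close>

lemma card_squares_mod_le_9:
  fixes A B :: int
  assumes "coprime A B" "A > 0" "B > 0"
    and "\<And>x y. x \<in> X \<Longrightarrow> [y = x] (mod A) \<Longrightarrow> y \<in> Y"
    and A: "nat A \<le> 9 * card (squares_mod A X)"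
  shows "card (squares_mod (A * B) UNIV) \<le> 9 * card (squares_mod (A * B) Y)"
proof -
  have "card (squares_mod (A * B) UNIV) \<le> nat A * card (squares_mod B UNIV)"
    using assms by (intro card_squares_mod_mult_le)
  also have "\<dots> \<le> 9 * card (squares_mod A X) * card (squares_mod B UNIV)"
    using A by (rule mult_le_mono1)
  also have "\<dots> \<le> 9 * card (squares_mod (A * B) Y)"
    using card_squares_mod_mult_ge[OF assms(1-4)] by (simp add: mult.assoc)
  finally show ?thesis .
qed

text \<open>With the full power of \<open>r\<close> in \<open>T\<close> as \<open>A\<close>, the
  cofactor is coprime to \<open>A\<close>, and being prime to \<open>r\<close> depends only on the
  class modulo \<open>A\<close>.\<close>

lemma card_squares_mod_le_9_of_prime:
  fixes r T :: int
  assumes "prime r" "r dvd T" "T > 0" and Y: "\<And>x. \<not> r dvd x \<Longrightarrow> x \<in> Y"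
  shows "card (squares_mod T UNIV) \<le> 9 * card (squares_mod T Y)"
proof -
  have "\<not> is_unit r" using assms(1) not_prime_unit by blast
  then obtain B where B: "T = r ^ multiplicity r T * B" "\<not> r dvd B"
    using assms(3) multiplicity_decompose'[of T r] by (metis less_irrefl mult.commute)
  define e where "e = multiplicity r T"
  have e: "e > 0" using assms by (auto simp: e_def prime_multiplicity_gt_zero_iff)
  have r: "r > 0" using assms(1) prime_gt_0_int by blast
  have "card (squares_mod (r ^ e * B) UNIV) \<le> 9 * card (squares_mod (r ^ e * B) Y)"
  proof (rule card_squares_mod_le_9)
    show "coprime (r ^ e) B" using B(2) assms(1) by (simp add: prime_imp_coprime)
    show "r ^ e > 0" using r by simp
    then show "B > 0" using assms(3) B(1) zero_less_mult_pos[of "r ^ e" B] by (simp add: e_def)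
    show "nat (r ^ e) \<le> 9 * card (squares_mod (r ^ e) {x. \<not> r dvd x})"
      using prime_power_le_8_card_squares_mod[OF assms(1) e] by linarith
  next
    fix x y :: int assume "x \<in> {x. \<not> r dvd x}" "[y = x] (mod r ^ e)"
    then have "\<not> r dvd y"
      using e by (metis cong_dvd_iff cong_dvd_modulus dvd_power mem_Collect_eq)
    then show "y \<in> Y" by (rule Y)
  qed
  then show ?thesis using B(1) by (simp add: e_def)
qed

text \<open>
  If no excluded residue has an excluded negative, every square has an admissible root. Otherwise
  either all \<open>x\<close> prime to some prime divisor of \<open>f\<close> are admissible, or \<open>4\<close> exactly divides \<open>T\<close> and
  all multiples of \<open>4\<close> are admissible.
\<close>

lemma card_squares_mod_avoiding_residue:
  fixes T f h :: int
  assumes f: "f > 2" and T: "T = f * h" "h > 0"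
  shows "card (squares_mod T UNIV) \<le> 9 * card (squares_mod T {x. \<not> [2 * x + h = 1] (mod f)})"
    (is "_ \<le> 9 * card (squares_mod T ?Y)")
proof (cases "\<exists>x. [2 * x + h = 1] (mod f) \<and> [- 2 * x + h = 1] (mod f)")
  case False
  have "squares_mod T UNIV \<subseteq> squares_mod T ?Y"
  proof
    fix s assume "s \<in> squares_mod T UNIV"
    then obtain x where x: "s = x\<^sup>2 mod T" by (auto simp: squares_mod_def)
    then have "s = (- x)\<^sup>2 mod T" by simp
    moreover have "x \<in> ?Y \<or> - x \<in> ?Y" using False by auto
    ultimately show "s \<in> squares_mod T ?Y" using x unfolding squares_mod_def by blast
  qed
  then have "card (squares_mod T UNIV) \<le> card (squares_mod T ?Y)"
    using f T by (intro card_mono finite_squares_mod) auto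
  then show ?thesis by simp
next
  case True
  then obtain x0 where "f dvd 2 * x0 + h - 1" "f dvd - 2 * x0 + h - 1"
    by (auto simp: cong_iff_dvd_diff)
  \<comment> \<open>The sum eliminates \<open>x0\<close>.\<close>
  from dvd_add[OF this] have h2: "f dvd 2 * (h - 1)" by (simp add: algebra_simps)
  have T0: "T > 0" using f T by simp
  have bad: "f dvd 2 * x + (h - 1)" if "x \<notin> ?Y" for x
    using that by (simp add: cong_iff_dvd_diff algebra_simps)
  consider r where "prime r" "odd r" "r dvd f" | "4 dvd f"
  proof -
    have "nat f > 2" using f by simp
    from odd_prime_or_4_dvd[OF this] show ?thesis
    proof
      assume "\<exists>r. prime r \<and> odd r \<and> r dvd nat f"
      then obtain r where r: "prime r" "odd r" "r dvd nat f" by blast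
      have "int r dvd f" using r(3) f of_nat_dvd_iff[of r "nat f", where 'a = int] by simp
      with r show ?thesis by (intro that(1)[of "int r"]) auto
    next
      assume "4 dvd nat f"
      then show ?thesis using f of_nat_dvd_iff[of 4 "nat f", where 'a = int] by (intro that(2)) simp
    qed
  qed
  then show ?thesis
  proof cases
    case 1
    have r2: "\<not> r dvd 2" using 1 zdvd_imp_le[of r 2] prime_ge_2_int[of r] by auto
    \<comment> \<open>As \<open>r\<close> is odd, the 2 cancels; every excluded \<open>x\<close> is
      then a multiple of \<open>r\<close>.\<close>
    have rh: "r dvd h - 1" using h2 1 r2 by (meson dvd_trans prime_dvd_mult_iff)
    have "x \<in> ?Y" if "\<not> r dvd x" for x
    proof (rule ccontr)
      assume "x \<notin> ?Y"
      then have "r dvd 2 * x + (h - 1)" using bad 1(3) dvd_trans by blast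
      then have "r dvd 2 * x" using rh by (simp add: dvd_add_left_iff)
      then show False using that r2 1(1) by (simp add: prime_dvd_mult_iff)
    qed
    then show ?thesis using 1 T T0 by (intro card_squares_mod_le_9_of_prime[of r]) auto
  next
    case 2
    show ?thesis
    \<comment> \<open>An excluded \<open>x\<close> satisfies \<open>4 dvd 2 * x + (h - 1)\<close>,
      so \<open>h - 1\<close> modulo 4 decides its parity.\<close>
    proof (cases "4 dvd h - 1")
      case True
      have "x \<in> ?Y" if "odd x" for x
      proof (rule ccontr)
        assume "x \<notin> ?Y"
        then have "4 dvd 2 * x + (h - 1)" using bad 2 dvd_trans by blast
        then have "4 dvd 2 * x" using True by (simp add: dvd_add_left_iff)
        then show False using that by presburger
      qed
      moreover have "2 dvd f" using 2 by presburger
      ultimately show ?thesis using T T0 by (intro card_squares_mod_le_9_of_prime[of 2]) auto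
    next
      case False
      obtain g where g: "f = 4 * g" using 2 by blast
      have "4 dvd 2 * (h - 1)" using h2 2 dvd_trans by blast
      then have "odd h" by presburger
      \<comment> \<open>Here \<open>h - 1\<close> is 2 modulo 4, so 8 does not divide
        \<open>2 * (h - 1)\<close>, a multiple of \<open>f\<close>.\<close>
      have "odd g"
      proof
        assume "even g"
        then have "8 dvd f" using g by presburger
        then have "8 dvd 2 * (h - 1)" using h2 dvd_trans by blast
        with False show False by presburger
      qed
      have gh: "T = 4 * (g * h)" using g T by simp
      have "card (squares_mod (4 * (g * h)) UNIV) \<le> 9 * card (squares_mod (4 * (g * h)) ?Y)"
      \<comment> \<open>Excluded \<open>x\<close> are odd here, so the class of 0 modulo 4 is
        admissible; its single square already gives \<open>4 \<le> 9 * 1\<close>.\<close>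
      proof (rule card_squares_mod_le_9[where X = "{0}"])
        have "coprime (2 ^ 2) (g * h)"
          using \<open>odd g\<close> \<open>odd h\<close> by (simp only: coprime_power_left_iff) simp
        then show "coprime 4 (g * h)" by (simp only: power2_eq_square) simp
        show "g * h > 0" using gh T0 by simp
        fix x y :: int assume "x \<in> {0}" "[y = x] (mod 4)"
        then have "4 dvd y" by (simp add: cong_0_iff)
        show "y \<in> ?Y"
        proof (rule ccontr)
          assume "y \<notin> ?Y"
          then have "4 dvd 2 * y + (h - 1)" using bad 2 dvd_trans by blast
          then have "4 dvd h - 1" using \<open>4 dvd y\<close> by presburger
          with False show False by simp
        qed
      qed (auto simp: squares_mod_def)
      then show ?thesis using gh by simp
    qed
  qed
qed

section \<open>The prime field, cosets of subspaces and linearised polynomials\<close>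

lemma CHAR_finite_field:
  assumes "prime p" "CARD('a :: finite_field) = p ^ n"
  shows "CHAR('a) = p"
proof -
  have "prime CHAR('a)" by (intro prime_CHAR_semidom finite_imp_CHAR_pos) simp
  \<comment> \<open>Translation by 1 permutes the field, so comparing the two sums shows that the
    field size vanishes in the field.\<close>
  moreover have "(\<Sum>x\<in>UNIV. x + 1 :: 'a) = (\<Sum>x\<in>UNIV. x)"
    by (rule sum.reindex_bij_witness[of _ "\<lambda>x. x - 1" "\<lambda>x. x + 1"]) auto
  then have "of_nat CARD('a) = (0 :: 'a)" by (simp add: sum.distrib)
  then have "CHAR('a) dvd p ^ n" using assms(2) by (simp only: of_nat_eq_0_iff_char_dvd)
  ultimately show ?thesis using assms(1) by (metis prime_dvd_power primes_dvd_imp_eq)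
qed

lemma of_int_eq_of_nat_mod_CHAR:
  assumes "CHAR('a :: finite_field) > 0"
  shows "(of_int i :: 'a) = of_nat (nat (i mod int CHAR('a)))"
proof -
  have "(of_int i :: 'a) = of_int (i mod int CHAR('a))"
    unfolding of_int_eq_iff_cong_CHAR by (simp add: cong_def)
  also have "\<dots> = of_nat (nat (i mod int CHAR('a)))" using assms by (intro of_nat_nat[symmetric]) simp
  finally show ?thesis .
qed

lemma range_of_int_eq_image:
  assumes "CHAR('a :: finite_field) > 0"
  shows "range (of_int :: int \<Rightarrow> 'a) = of_nat ` {..<CHAR('a)}"
proof (intro equalityI subsetI)
  fix x :: 'a assume "x \<in> range of_int"
  then obtain i where "x = of_int i" by blast
  then have "x = of_nat (nat (i mod int CHAR('a)))"
    using of_int_eq_of_nat_mod_CHAR[OF assms, of i] by (rule trans)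
  moreover have "nat (i mod int CHAR('a)) < CHAR('a)" using assms by (simp add: nat_less_iff)
  ultimately show "x \<in> of_nat ` {..<CHAR('a)}" by (intro image_eqI lessThan_iff[THEN iffD2])
qed (metis imageE of_int_of_nat_eq rangeI)

lemma card_range_of_int:
  assumes "CHAR('a :: finite_field) > 0"
  shows "card (range (of_int :: int \<Rightarrow> 'a)) = CHAR('a)"
proof -
  have "inj_on (of_nat :: nat \<Rightarrow> 'a) {..<CHAR('a)}"
    by (rule inj_onI) (simp add: of_nat_eq_iff_cong_CHAR cong_def)
  then show ?thesis by (simp add: range_of_int_eq_image[OF assms] card_image)
qed

text \<open>The elements of the prime field are the at most \<open>p\<close> roots of \<open>X\<^sup>p - X\<close>.\<close>

lemma fixed_by_frobenius_imp_range_of_int: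
  fixes x :: "'a :: finite_field"
  assumes "prime p" "CHAR('a) = p" "x ^ p = x"
  shows "x \<in> range of_int"
proof -
  let ?q = "monom 1 p - monom 1 1 :: 'a poly"
  have p: "p > 1" using assms(1) prime_gt_1_nat by blast
  then have "CHAR('a) > 0" using assms(2) by simp
  have "coeff ?q p = 1" using p by simp
  then have q0: "?q \<noteq> 0" by (metis coeff_0 zero_neq_one)
  have deg: "degree ?q \<le> p" using p by (intro degree_diff_le) (simp_all add: degree_monom_eq)
  have roots: "{x :: 'a. poly ?q x = 0} = {x. x ^ p = x}" by (simp add: poly_monom)
  have "card {x :: 'a. x ^ p = x} \<le> p"
    using card_poly_roots_bound[OF q0] deg unfolding roots by linarith
  moreover have "(of_nat i :: 'a) ^ p = of_nat i" for i
  proof (induction i)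
    case 0
    then show ?case using p by simp
  next
    case (Suc i)
    have "(of_nat i + 1 :: 'a) ^ p = of_nat i ^ p + 1 ^ p"
      by (rule freshmans_dream) (use assms in simp_all)
    then show ?case unfolding Suc of_nat_Suc by (simp add: add.commute)
  qed
  then have "range of_int \<subseteq> {x :: 'a. x ^ p = x}"
    unfolding range_of_int_eq_image[OF \<open>CHAR('a) > 0\<close>] by blast
  moreover have "card (range (of_int :: int \<Rightarrow> 'a)) = p"
    using card_range_of_int[where 'a = 'a] assms(2) p by simp
  ultimately have "range of_int = {x :: 'a. x ^ p = x}"
    by (intro card_seteq) auto
  then show ?thesis using assms(3) by blast
qed

lemma subspace_mult_closed:
  assumes "Fp.subspace U" "c \<in> range of_int" "x \<in> U"
  shows "c * x \<in> U"
  using Fp.subspace_scale[OF assms(1,3), of "Abs_prime_subfield c"] assms(2)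
  by (simp add: scale_prime_subfield_def Abs_prime_subfield_inverse)

text \<open>Each further generator brings one coefficient from the prime field, hence at most a
  factor \<open>p\<close>.\<close>

lemma card_span_le:
  fixes C :: "'a :: finite_field set"
  assumes "CHAR('a) = p" "p > 0"
  shows "card (Fp.span C) \<le> p ^ card C"
proof -
  have "finite C" by simp
  then show ?thesis
  proof (induction C)
    case empty
    then show ?case by simp
  next
    case (insert b S)
    let ?h = "\<lambda>(c, y). c * b + y"
    have "Fp.span (insert b S) \<subseteq> ?h ` (range of_int \<times> Fp.span S)"
    proof
      fix x assume "x \<in> Fp.span (insert b S)"
      then obtain c where "x - scale_prime_subfield c b \<in> Fp.span S"
        by (auto simp: Fp.span_insert)
      moreover have "x = ?h (Rep_prime_subfield c, x - scale_prime_subfield c b)"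
        by (simp add: scale_prime_subfield_def)
      ultimately show "x \<in> ?h ` (range of_int \<times> Fp.span S)"
        using Rep_prime_subfield[of c] by blast
    qed
    then have "card (Fp.span (insert b S)) \<le> card (range (of_int :: int \<Rightarrow> 'a) \<times> Fp.span S)"
      by (intro surj_card_le) auto
    also have "\<dots> = p * card (Fp.span S)"
      using card_range_of_int[where 'a = 'a] assms by (simp add: card_cartesian_product)
    also have "\<dots> \<le> p ^ card (insert b S)" using insert by simp
    finally show ?case .
  qed
qed

text \<open>A basis \<open>B\<close> of \<open>U\<close> extends to a basis \<open>D\<close> of the
  whole field; every coset has a representative in the span of the \<open>k\<close> elements of
  \<open>D - B\<close>.\<close>

lemma card_cosets_le:
  fixes U :: "'a :: finite_field set"
  assumes "CHAR('a) = p" "p > 0" "Fp.subspace U"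
    and k: "Fp.dim U + k = Fp.dim (UNIV :: 'a set)"
  shows "card (range (\<lambda>z. (\<lambda>u. u + z) ` U)) \<le> p ^ k"
proof -
  obtain B where B: "B \<subseteq> U" "Fp.independent B" "U \<subseteq> Fp.span B" "card B = Fp.dim U"
    by (rule Fp.basis_exists)
  obtain D where D: "B \<subseteq> D" "D \<subseteq> UNIV" "Fp.independent D" "UNIV \<subseteq> Fp.span D"
    using Fp.maximal_independent_subset_extend[OF subset_UNIV B(2)] by blast
  have "card D = Fp.dim (UNIV :: 'a set)" using D by (intro Fp.basis_card_eq_dim) auto
  then have card: "card (D - B) = k" using k B(4) D(1) by (simp add: card_Diff_subset)
  let ?c = "\<lambda>z. (\<lambda>u. u + z) ` U"
  have "range ?c \<subseteq> ?c ` Fp.span (D - B)"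
  proof clarify
    fix z
    have "z \<in> Fp.span (B \<union> (D - B))" using D(1,4) by (metis Un_Diff_cancel Un_absorb1 UNIV_I subsetD)
    then obtain x y where xy: "z = x + y" "x \<in> Fp.span B" "y \<in> Fp.span (D - B)"
      unfolding Fp.span_Un by blast
    have x: "x \<in> U" using xy(2) B(1) assms(3) Fp.span_minimal by blast
    have "?c z = ?c y"
    proof (intro equalityI subsetI)
      fix w assume "w \<in> ?c z"
      then obtain u where u: "u \<in> U" "w = u + z" by blast
      then have "u + x \<in> U" "w = (u + x) + y"
        using x xy(1) assms(3) by (auto simp: Fp.subspace_add)
      then show "w \<in> ?c y" by blast
    next
      fix w assume "w \<in> ?c y"
      then obtain u where u: "u \<in> U" "w = u + y" by blast
      then have "u - x \<in> U" "w = (u - x) + z"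
        using x xy(1) assms(3) by (auto simp: Fp.subspace_diff)
      then show "w \<in> ?c z" by blast
    qed
    then show "?c z \<in> ?c ` Fp.span (D - B)" using xy(3) by blast
  qed
  then have "card (range ?c) \<le> card (Fp.span (D - B))" by (intro surj_card_le) auto
  also have "\<dots> \<le> p ^ k" using card_span_le[OF assms(1,2), of "D - B"] card by simp
  finally show ?thesis .
qed

text \<open>Multiplication by a nonzero element of the prime field maps \<open>U\<close> onto
  itself, so the coset of \<open>c * z\<close> is determined by the coset of
  \<open>z\<close>.\<close>

lemma image_add_mult_subspace:
  fixes c z :: "'a :: finite_field"
  assumes "Fp.subspace U" "c \<in> range of_int" "c \<noteq> 0"
  shows "(\<lambda>u. u + c * z) ` U = (*) c ` (\<lambda>u. u + z) ` U"
proof -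
  have "u \<in> (*) c ` U" if "u \<in> U" for u
  proof -
    have "inverse c * u \<in> U"
      using assms(1) inverse_in_range_of_int[OF assms(2)] that by (rule subspace_mult_closed)
    moreover have "u = c * (inverse c * u)" using assms(3) by simp
    ultimately show ?thesis by blast
  qed
  then have "(*) c ` U = U" using subspace_mult_closed[OF assms(1,2)] by blast
  then have "(\<lambda>u. u + c * z) ` U = (\<lambda>u. u + c * z) ` (*) c ` U" by simp
  then show ?thesis by (simp add: image_image algebra_simps)
qed

text \<open>All exponents are powers of \<open>p\<close>, and iterating \<open>c ^ p = c\<close>
  gives \<open>c ^ p ^ j = c\<close>.\<close>

lemma poly_linearised_mult:
  assumes "linearised_poly p n M" "c ^ p = c"
  shows "poly M (c * z) = c * poly M z"
proof -
  obtain b where M: "M = (\<Sum>j<n. monom (b j) (p ^ j))"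
    using assms(1) by (auto simp: linearised_poly_def)
  have "c ^ p ^ j = c" for j
    by (induction j) (simp_all add: assms(2) power_mult mult.commute[of p])
  then show ?thesis
    by (simp add: M poly_sum poly_monom power_mult_distrib sum_distrib_left algebra_simps)
qed

section \<open>Multiplicative order and powers with integer exponents\<close>

lemma power_mult_order:
  fixes g :: "'a :: finite_field"
  assumes "g \<noteq> 0"
  shows "mult_order g > 0" "g ^ mult_order g = 1"
proof -
  have "CARD('a) \<ge> 2"
    using card_mono[of "UNIV :: 'a set" "{0, 1}"] by simp
  then have *: "CARD('a) - 1 > 0" "g ^ (CARD('a) - 1) * g = g"
    by (simp_all add: finite_field_power_card_eq_same flip: power_Suc2)
  then have "g ^ (CARD('a) - 1) = 1" using assms by simp
  \<comment> \<open>The exponent \<open>CARD('a) - 1\<close> witnesses that the \<open>LEAST\<close>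
    in \<open>mult_order\<close> is attained.\<close>
  with *(1) have "mult_order g > 0 \<and> g ^ mult_order g = 1"
    unfolding mult_order_def by (intro LeastI[of "\<lambda>t. t > 0 \<and> g ^ t = 1"] conjI)
  then show "mult_order g > 0" "g ^ mult_order g = 1" by auto
qed

text \<open>Reducing an exponent modulo the order leaves some \<open>t\<close> below the order; by
  minimality its power is 1 only for \<open>t = 0\<close>.\<close>

lemma powi_eq_iff_cong_mult_order:
  fixes g :: "'a :: finite_field"
  assumes "g \<noteq> 0"
  shows "g powi i = g powi j \<longleftrightarrow> [i = j] (mod int (mult_order g))"
proof -
  define T where "T = mult_order g"
  have T: "T > 0" "g ^ T = 1" using power_mult_order[OF assms] by (simp_all add: T_def)
  have one: "g powi l = 1 \<longleftrightarrow> int T dvd l" for l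
  proof -
    define t where "t = nat (l mod int T)"
    have t: "t < T" "int t = l mod int T" using T(1) by (simp_all add: t_def nat_less_iff)
    have "l = int T * (l div int T) + int t" by (simp add: t(2))
    then have "g powi l = (g powi int T) powi (l div int T) * g powi int t"
      using assms by (metis power_int_add power_int_mult)
    then have "g powi l = g ^ t" using T(2) by simp
    moreover have "g ^ t = 1 \<longleftrightarrow> t = 0"
      using not_less_Least[of t "\<lambda>t. t > 0 \<and> g ^ t = 1"] t(1) by (auto simp: T_def mult_order_def)
    moreover have "t = 0 \<longleftrightarrow> int T dvd l" using t(2) by (metis dvd_eq_mod_eq_0 of_nat_eq_0_iff)
    ultimately show ?thesis by simp
  qed
  have "g powi i = g powi j \<longleftrightarrow> g powi (i - j) = 1" using assms by (simp add: power_int_diff)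
  then show ?thesis by (simp add: one cong_iff_dvd_diff T_def)
qed

text \<open>Passes from values of the map \<open>d\<close> to squares of residues, since
  \<open>g powi s\<close> determines \<open>s\<close> modulo the order.\<close>

lemma card_squares_of_exponents:
  fixes g :: "'a :: finite_field"
  assumes "g \<noteq> 0"
  shows "card ((\<lambda>x :: int. g powi x\<^sup>2) ` Y) = card (squares_mod (int (mult_order g)) Y)"
proof -
  let ?T = "int (mult_order g)"
  have "(\<lambda>x. g powi x\<^sup>2) ` Y = (\<lambda>s. g powi s) ` squares_mod ?T Y"
    unfolding squares_mod_def image_image
    by (rule image_cong[OF refl]) (simp add: powi_eq_iff_cong_mult_order[OF assms] cong_def)
  moreover have "inj_on (\<lambda>s. g powi s) (squares_mod ?T Y)"
    by (auto simp: inj_on_def squares_mod_def powi_eq_iff_cong_mult_order[OF assms] cong_def)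
  ultimately show ?thesis by (simp add: card_image)
qed

section \<open>Bounding the number of cosets from below\<close>

theorem theorem3p3:
  fixes p n T m k f :: nat
    and \<gamma> :: "'a :: finite_field"
    and d F :: "'a \<Rightarrow> 'a"
    and U :: "'a set"
    and M :: "'a poly"
    and a :: "'a set \<Rightarrow> 'a"
  assumes "prime p" and "n \<ge> 1" and "CARD('a) = p ^ n"
    and "\<gamma> \<noteq> 0" and "mult_order \<gamma> = T"
    and "\<And>x :: int. d (\<gamma> powi x) = \<gamma> powi (x\<^sup>2)"
    and "m \<le> T"
    and "card {\<zeta> \<in> cyclic_subgroup \<gamma>. F \<zeta> \<noteq> d \<zeta>} \<le> m"
    and "Fp.subspace U" and "Fp.dim U + k = Fp.dim (UNIV :: 'a set)"
    and "linearised_poly p n M"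
    and "\<And>\<zeta>. F \<zeta> = poly M \<zeta> + a ((\<lambda>u. u + \<zeta>) ` U)"
    and "f > 2" and "f dvd T" and "f dvd p - 1"
  shows "real (p ^ k) \<ge> real (num_squares_mod T) / (9 * real f) - 2 * real m / real f"
proof -
  note p = assms(1) and \<gamma> = assms(4) and T = assms(5) and d = assms(6) and E_le = assms(8)
    and U = assms(9) and M = assms(11) and F = assms(12) and f2 = assms(13)
  have T0: "T > 0" and \<gamma>T: "\<gamma> ^ T = 1" using power_mult_order[OF \<gamma>] T by simp_all
  have char: "CHAR('a) = p" using p assms(3) by (rule CHAR_finite_field)
  obtain h where h: "T = f * h" using assms(14) by blast
  have h0: "h > 0" using T0 h by simp
  have eq_iff: "\<gamma> powi i = \<gamma> powi j \<longleftrightarrow> [i = j] (mod int T)" for i j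
    using powi_eq_iff_cong_mult_order[OF \<gamma>] T by simp

  define w where "w = \<gamma> ^ h"
  have w0: "w \<noteq> 0" using \<gamma> by (simp add: w_def)
  have w_powi: "w powi l = \<gamma> powi (int h * l)" for l
    by (simp add: w_def power_int_mult)
  \<comment> \<open>This says that \<open>w\<close> has order \<open>f\<close>: the factor
    \<open>h\<close> cancels from the modulus \<open>T = f * h\<close>.\<close>
  have w_eq_iff: "w powi i = w powi j \<longleftrightarrow> [i = j] (mod int f)" for i j
  proof -
    have "w powi i = w powi j \<longleftrightarrow> int h * int f dvd int h * (i - j)"
      by (simp add: w_powi eq_iff h cong_iff_dvd_diff algebra_simps)
    then show ?thesis using h0 by (simp add: cong_iff_dvd_diff)
  qed
  have wp: "w ^ p = w"
  proof -
    obtain l where l: "p - 1 = f * l" using assms(15) by blast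
    have "w ^ f = 1" using \<gamma>T by (simp add: w_def h mult.commute flip: power_mult)
    then have "w ^ (p - 1) = 1" unfolding l by (simp only: power_mult power_one)
    moreover have "w ^ p = w ^ (p - 1) * w"
      using prime_gt_0_nat[OF p] by (simp flip: power_Suc2)
    ultimately show ?thesis by simp
  qed
  have w_prime: "w \<in> range of_int" using p char wp by (rule fixed_by_frobenius_imp_range_of_int)

  define E where "E = {\<zeta> \<in> cyclic_subgroup \<gamma>. F \<zeta> \<noteq> d \<zeta>}"
  have E: "card E \<le> m" using E_le by (simp add: E_def)
  define coset where "coset z = (\<lambda>u. u + z) ` U" for z
  \<comment> \<open>The two contributions of \<open>M\<close> cancel, so only the constants attached
    to cosets survive.\<close>
  have step: "F (w * z) - w * F z = a ((*) w ` coset z) - w * a (coset z)" for z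
    unfolding F coset_def poly_linearised_mult[OF M wp] image_add_mult_subspace[OF U w_prime w0]
    by (simp add: distrib_left)
  have wz: "w * \<gamma> powi x = \<gamma> powi (x + int h)" for x
    using \<gamma> by (simp add: w_def power_int_add)

  \<comment> \<open>The excluded exponents are those with \<open>w powi (2 * x + int h) = w\<close>,
    for which the difference vanishes and gives no information on
    \<open>\<gamma> powi x\<^sup>2\<close>.\<close>
  define Y where "Y = {x. \<not> [2 * x + int h = 1] (mod int f)}"
  define good where "good = {x \<in> Y. \<gamma> powi x \<notin> E \<and> w * \<gamma> powi x \<notin> E}"
  define V where "V = (\<lambda>C. a ((*) w ` C) - w * a C) ` range coset"
  have V: "card V \<le> p ^ k"
  proof -
    have "card V \<le> card (range coset)" unfolding V_def by (rule card_image_le) simp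
    also have "\<dots> \<le> p ^ k"
      using card_cosets_le[OF char prime_gt_0_nat[OF p] U assms(10)] by (simp add: coset_def)
    finally show ?thesis .
  qed

  have value_in_V: "\<gamma> powi x\<^sup>2 * (w powi (2 * x + int h) - w) \<in> V" if "x \<in> good" for x
  proof -
    have "F (\<gamma> powi x) = \<gamma> powi x\<^sup>2" "F (w * \<gamma> powi x) = \<gamma> powi (x + int h)\<^sup>2"
      using that d by (auto simp: good_def E_def cyclic_subgroup_def wz)
    \<comment> \<open>This rests on
      \<open>(x + h)\<^sup>2 = x\<^sup>2 + h * (2 * x + h)\<close>.\<close>
    moreover have "\<gamma> powi (x + int h)\<^sup>2 = \<gamma> powi x\<^sup>2 * w powi (2 * x + int h)"
      using \<gamma> by (simp add: w_powi power2_eq_square algebra_simps flip: power_int_add)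
    ultimately have "\<gamma> powi x\<^sup>2 * (w powi (2 * x + int h) - w)
        = F (w * \<gamma> powi x) - w * F (\<gamma> powi x)"
      by (simp add: algebra_simps)
    then show ?thesis unfolding step V_def by blast
  qed
  let ?sq = "\<lambda>x. \<gamma> powi x\<^sup>2"
  \<comment> \<open>The square power is recovered from the value in \<open>V\<close> together with
    \<open>j\<close>, the residue of \<open>2 * x + h\<close> modulo \<open>f\<close>. Pairs with
    \<open>j = 1\<close> divide by zero, which merely enlarges the covering set.\<close>
  have "?sq ` good \<subseteq> (\<lambda>(v, j). v / (w powi j - w)) ` (V \<times> {0..<int f})"
  proof (rule image_subsetI)
    fix x assume x: "x \<in> good"
    define j where "j = (2 * x + int h) mod int f"
    have wj: "w powi j = w powi (2 * x + int h)" unfolding w_eq_iff by (simp add: j_def cong_def)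
    have "w powi j \<noteq> w powi 1" using x unfolding wj w_eq_iff by (simp add: good_def Y_def)
    then have "w powi j - w \<noteq> 0" by simp
    then have "?sq x = (\<lambda>(v, j). v / (w powi j - w)) (?sq x * (w powi j - w), j)" by simp
    moreover have "(?sq x * (w powi j - w), j) \<in> V \<times> {0..<int f}"
      using value_in_V[OF x] f2 by (simp add: wj) (simp add: j_def)
    ultimately show "?sq x \<in> (\<lambda>(v, j). v / (w powi j - w)) ` (V \<times> {0..<int f})"
      by (rule image_eqI)
  qed
  then have "card (?sq ` good) \<le> card (V \<times> {0..<int f})" by (intro surj_card_le) simp_all
  then have card_good: "card (?sq ` good) \<le> p ^ k * f"
    using V by (simp add: card_cartesian_product) (meson le_trans mult_le_mono1)

  \<comment> \<open>An admissible exponent that is not good has \<open>\<gamma> powi x\<close> or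
    \<open>w * \<gamma> powi x\<close> in \<open>E\<close>. Either point determines
    \<open>?sq x\<close>, so each alternative accounts for at most \<open>m\<close> values.\<close>
  have "?sq ` Y \<subseteq> ?sq ` good \<union> d ` E \<union> (\<lambda>e. d (e / w)) ` E"
  proof (rule image_subsetI)
    fix x assume "x \<in> Y"
    then consider "x \<in> good" | "\<gamma> powi x \<in> E" | "w * \<gamma> powi x \<in> E" by (auto simp: good_def)
    then show "?sq x \<in> ?sq ` good \<union> d ` E \<union> (\<lambda>e. d (e / w)) ` E"
    proof cases
      case 3
      have "?sq x = d (w * \<gamma> powi x / w)" using w0 d by simp
      then show ?thesis using 3 by blast
    qed (use d in \<open>auto simp flip: d\<close>)
  qed
  then have "card (?sq ` Y) \<le> card (?sq ` good \<union> d ` E \<union> (\<lambda>e. d (e / w)) ` E)"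
    by (intro card_mono) simp_all
  also have "\<dots> \<le> card (?sq ` good) + card (d ` E) + card ((\<lambda>e. d (e / w)) ` E)"
    by (meson add_le_mono1 card_Un_le le_trans)
  also have "\<dots> \<le> p ^ k * f + m + m"
    using card_good E card_image_le[of E d] card_image_le[of E "\<lambda>e. d (e / w)"] by simp
  finally have card_sq: "card (?sq ` Y) \<le> p ^ k * f + 2 * m" by simp

  have num: "num_squares_mod T \<le> 9 * card (?sq ` Y)"
    using card_squares_mod_avoiding_residue[of "int f" "int T" "int h"] f2 h h0
      card_squares_of_exponents[OF \<gamma>, of Y] card_squares_mod_eq_num_squares_mod[OF T0]
    by (simp add: Y_def T)
  have "num_squares_mod T \<le> 9 * (p ^ k * f + 2 * m)"
    by (rule order_trans[OF num]) (rule mult_le_mono2[OF card_sq])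
  then have "real (num_squares_mod T) \<le> real (9 * (p ^ k * f + 2 * m))" by (rule of_nat_mono)
  then show ?thesis using f2 by (simp add: field_simps)
qed

end
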